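(* Let $s_{k,n}$ denote the number of directed plateau polycubes of width $k$ and lateral area $n$. Then, for all integers $k\geq 1$ and $n\geq 2k$, $$s_{k,n}=\binom{n+2k-3}{n-2k}.$$
   Context: A cell is a unit cube of the lattice $\mathbb{Z}^3$ with orthonormal coordinate system $(0,\vec i,\vec j,\vec k)$. A polycube is a finite (nonempty) union of cells, connected through their faces, and considered up to translation. Its width is the difference between its greatest and smallest indices (coordinates of its points) in the direction $\vec i$, i.e. the number of layers of cells it occupies in direction $\vec i$. A stratum is a polycube of width $1$; a plateau is a rectangular stratum (a full $1\times b\times c$ block of cells, of extent $1$ in direction $\vec i$). A plateau polycube is a polycube whose strata (its intersections with the successive unit-width layers orthogonal to $\vec i$) are all plateaus. A polycube is directed if each of its cells can be reached from a distinguished cell of the polycube, called the root, by a path inside the polycube made only of East (one unit in direction $\vec i$), North (one unit in direction $\vec j$) and Ahead (one unit in direction $\vec k$) steps. A directed plateau polycube is a plateau polycube that is directed. The lateral area of a polycube is the sum of the areas (numbers of unit squares) of its projections onto the planes $(\vec i,\vec j)$ and $(\vec i,\vec k)$. Convention: $\binom{n}{k}=\frac{n!}{k!(n-k)!}$ if $0\le k\le n$ and $\binom{n}{k}=0$ otherwise. *)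

theory Defs
  imports Main "HOL-Library.Product_Plus"
begin

text \<open>
  The triple \<open>(a, b, c)\<close> stands for the unit cube
  \<open>[a, a + 1] \<times> [b, b + 1] \<times> [c, c + 1]\<close>; its components are the coordinates in the
  directions \<open>i\<close>, \<open>j\<close> and \<open>k\<close>. A union of cells is represented by the set of its cells.
\<close>

type_synonym cell = "int \<times> int \<times> int"

definition face_adjacent :: "cell \<Rightarrow> cell \<Rightarrow> bool" where
  "face_adjacent = (\<lambda>(a, b, c) (a', b', c'). \<bar>a - a'\<bar> + \<bar>b - b'\<bar> + \<bar>c - c'\<bar> = 1)"

definition polycube :: "cell set \<Rightarrow> bool" where
  "polycube P \<longleftrightarrow> finite P \<and> P \<noteq> {} \<and>
     (\<forall>x\<in>P. \<forall>y\<in>P. (x, y) \<in> {(u, v). u \<in> P \<and> v \<in> P \<and> face_adjacent u v}\<^sup>*)"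

text \<open>
  The points of a cell with first index \<open>a\<close> have first coordinates between \<open>a\<close> and \<open>a + 1\<close>,
  which accounts for the \<open>+ 1\<close> below.
\<close>

definition width :: "cell set \<Rightarrow> int" where
  "width P = Max (fst ` P) + 1 - Min (fst ` P)"

definition stratum :: "cell set \<Rightarrow> bool" where
  "stratum S \<longleftrightarrow> polycube S \<and> width S = 1"

definition plateau :: "cell set \<Rightarrow> bool" where
  "plateau S \<longleftrightarrow> stratum S \<and> (\<exists>a b b' c c'. S = {a} \<times> {b..b'} \<times> {c..c'})"

definition layer :: "int \<Rightarrow> cell set" where
  "layer a = {x. fst x = a}"

definition plateau_polycube :: "cell set \<Rightarrow> bool" where
  "plateau_polycube P \<longleftrightarrow> polycube P \<and>
     (\<forall>a\<in>{Min (fst ` P)..Max (fst ` P)}. plateau (P \<inter> layer a))"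

definition directed_step :: "cell \<Rightarrow> cell \<Rightarrow> bool" where
  "directed_step x y \<longleftrightarrow> y = x + (1, 0, 0) \<or> y = x + (0, 1, 0) \<or> y = x + (0, 0, 1)"

definition directed :: "cell set \<Rightarrow> bool" where
  "directed P \<longleftrightarrow>
     (\<exists>r\<in>P. \<forall>x\<in>P. (r, x) \<in> {(u, v). u \<in> P \<and> v \<in> P \<and> directed_step u v}\<^sup>*)"

definition directed_plateau_polycube :: "cell set \<Rightarrow> bool" where
  "directed_plateau_polycube P \<longleftrightarrow> plateau_polycube P \<and> directed P"

definition lateral_area :: "cell set \<Rightarrow> nat" where
  "lateral_area P = card ((\<lambda>(a, b, c). (a, b)) ` P) + card ((\<lambda>(a, b, c). (a, c)) ` P)"

definition translation_rel :: "(cell set \<times> cell set) set" where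
  "translation_rel = {(P, Q). \<exists>t. Q = (\<lambda>x. x + t) ` P}"

text \<open>
  Polycubes are counted up to translation; all the properties involved are invariant under
  translation, so each class below consists of polycubes satisfying them.
\<close>

definition num_directed_plateau :: "nat \<Rightarrow> nat \<Rightarrow> nat" where
  "num_directed_plateau k n =
     card ({P. directed_plateau_polycube P \<and> width P = int k \<and> lateral_area P = n}
           // translation_rel)"

end

theory Submission
  imports Defs "HOL-Library.More_List"
begin

text \<open>
  In a directed plateau polycube, consider the cell of a layer with the least second and third
  coordinates. Unless the layer is the first one, a directed path from the root can enter this
  cell only by an East step, since the cells from which a North or an Ahead step would lead to it
  lie outside the rectangle. Hence the least corner of every layer but the first, shifted back by
  one unit, belongs to the previous layer. Conversely, any sequence of rectangles with this
  property is directed: from the least corner of a rectangle one reaches all its cells, among them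
  the one below the next corner. These two facts are \<open>directed_plateau_polycube_imp_stack\<close> and
  \<open>directed_plateau_polycube_stack\<close>.

  The condition separates into one for each lateral direction: a sequence of \<open>k\<close> integer
  intervals, each starting inside its predecessor. The lateral area is the total number of
  integers in all these intervals. Up to translation, an interval of length \<open>L\<close> whose successor
  starts at distance \<open>d\<close> from its own left end amounts to the pair of natural numbers \<open>d\<close> and
  \<open>L - 1 - d\<close>, and the last interval to the single number \<open>L - 1\<close>. Each direction thus
  contributes \<open>2 * (k - 1) + 1\<close> free natural numbers, whose sum is the total length minus \<open>k\<close>.
  So the polycubes correspond to lists of \<open>4 * k - 2\<close> natural numbers with sum \<open>n - 2 * k\<close>
  (\<open>decode_surj\<close>, \<open>decode_inj\<close>, \<open>lateral_area_decode\<close>), and the formula of stars and bars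
  counts these.
\<close>

section \<open>Stacks of rectangles\<close>

definition stack ::
  "int \<Rightarrow> int \<Rightarrow> (int \<Rightarrow> int) \<Rightarrow> (int \<Rightarrow> int) \<Rightarrow> (int \<Rightarrow> int) \<Rightarrow> (int \<Rightarrow> int) \<Rightarrow> cell set" where
  "stack m M b b' c c' =
     {(x, y, z). x \<in> {m..M} \<and> y \<in> {b x..b' x} \<and> z \<in> {c x..c' x}}"

text \<open>
  This is the condition on one lateral direction: the values of \<open>b\<close> and \<open>b'\<close> are the ends of the
  intervals occupied by the successive layers.
\<close>

definition linked :: "int \<Rightarrow> int \<Rightarrow> (int \<Rightarrow> int) \<Rightarrow> (int \<Rightarrow> int) \<Rightarrow> bool" where
  "linked m M b b' \<longleftrightarrow>
     (\<forall>x\<in>{m..M}. b x \<le> b' x) \<and> (\<forall>x\<in>{m..<M}. b (x + 1) \<in> {b x..b' x})"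

lemma linked_translate:
  assumes "linked m M b b'"
  shows "linked (m + t) (M + t) (\<lambda>x. b (x - t) + s) (\<lambda>x. b' (x - t) + s)"
proof -
  have "b (x - t) \<le> b' (x - t)" if "x \<in> {m + t..M + t}" for x
    using assms that by (simp add: linked_def)
  moreover have "b (x + 1 - t) \<in> {b (x - t)..b' (x - t)}" if "x \<in> {m + t..<M + t}" for x
  proof -
    have "x + 1 - t = (x - t) + 1" "x - t \<in> {m..<M}"
      using that by auto
    then show ?thesis
      using assms unfolding linked_def by metis
  qed
  ultimately show ?thesis
    by (auto simp: linked_def)
qed

lemma linked_single: "linked m M b b' \<Longrightarrow> x \<in> {m..M} \<Longrightarrow> linked x x b b'"
  by (simp add: linked_def)

text \<open>
  Directed steps are face adjacencies, and adjacency is symmetric, so any two cells are joined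
  through the root. Directedness is therefore all that has to be checked for connectedness, both
  for a whole stack and for its single layers.
\<close>

lemma directed_imp_polycube:
  assumes "finite P" and "directed P"
  shows "polycube P"
proof -
  let ?A = "{(u, v). u \<in> P \<and> v \<in> P \<and> face_adjacent u v}"
  let ?D = "{(u, v). u \<in> P \<and> v \<in> P \<and> directed_step u v}"
  obtain r where r: "r \<in> P" and reach: "\<And>x. x \<in> P \<Longrightarrow> (r, x) \<in> ?D\<^sup>*"
    using assms(2) by (auto simp: directed_def)
  have "?D \<subseteq> ?A"
    by (auto simp: directed_step_def face_adjacent_def)
  then have reachA: "(r, x) \<in> ?A\<^sup>*" if "x \<in> P" for x
    using reach[OF that] rtrancl_mono by blast
  have "sym ?A"
    by (auto simp: sym_def face_adjacent_def abs_minus_commute)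
  then have "sym (?A\<^sup>*)"
    by (rule sym_rtrancl)
  then have "(x, y) \<in> ?A\<^sup>*" if "x \<in> P" "y \<in> P" for x y
    using reachA[OF that(1)] reachA[OF that(2)] by (meson rtrancl_trans symD)
  then show ?thesis
    using assms(1) r by (auto simp: polycube_def)
qed

lemma finite_stack: "finite (stack m M b b' c c')"
proof (rule finite_subset)
  show "stack m M b b' c c' \<subseteq> (SIGMA x:{m..M}. {b x..b' x} \<times> {c x..c' x})"
    by (auto simp: stack_def)
qed auto

text \<open>
  The linking condition lets directed paths climb from one least corner to the next: the cell just
  before the next corner lies in the present rectangle, all of which is reached from its own least
  corner, first in one lateral direction and then in the other.
\<close>

lemma directed_stack:
  assumes "m \<le> M" and b: "linked m M b b'" and c: "linked m M c c'"
  shows "directed (stack m M b b' c c')"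
proof -
  let ?P = "stack m M b b' c c'"
  let ?D = "{(u, v). u \<in> ?P \<and> v \<in> ?P \<and> directed_step u v}"
  let ?r = "(m, b m, c m)"
  have column: "(?r, (x, y, z)) \<in> ?D\<^sup>*"
    if x: "x \<in> {m..M}" and corner: "(?r, (x, b x, c x)) \<in> ?D\<^sup>*"
      and y: "y \<in> {b x..b' x}" and z: "z \<in> {c x..c' x}" for x y z
  proof -
    have cz: "c x \<le> z" and zc: "z \<le> c' x" and by': "b x \<le> y" and yb: "y \<le> b' x"
      using y z by auto
    from by' yb have row: "(?r, (x, y, c x)) \<in> ?D\<^sup>*"
    proof (induction y rule: int_ge_induct)
      case base
      then show ?case using corner by simp
    next
      case (step y)
      have "((x, y, c x), (x, y + 1, c x)) \<in> ?D"
        using step x cz zc by (auto simp: stack_def directed_step_def)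
      moreover have "(?r, (x, y, c x)) \<in> ?D\<^sup>*"
        using step by simp
      ultimately show ?case by (rule rtrancl_into_rtrancl[rotated])
    qed
    from cz zc show ?thesis
    proof (induction z rule: int_ge_induct)
      case base
      then show ?case using row by simp
    next
      case (step z)
      have "((x, y, z), (x, y, z + 1)) \<in> ?D"
        using step x y by (auto simp: stack_def directed_step_def)
      moreover have "(?r, (x, y, z)) \<in> ?D\<^sup>*"
        using step by simp
      ultimately show ?case by (rule rtrancl_into_rtrancl[rotated])
    qed
  qed
  have corner: "(?r, (x, b x, c x)) \<in> ?D\<^sup>*" if "m \<le> x" "x \<le> M" for x
    using that
  proof (induction x rule: int_ge_induct)
    case base
    then show ?case by simp
  next
    case (step x)
    have mem: "b (x + 1) \<in> {b x..b' x}" "c (x + 1) \<in> {c x..c' x}"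
      using step b c by (auto simp: linked_def)
    have "(?r, (x, b (x + 1), c (x + 1))) \<in> ?D\<^sup>*"
    proof (rule column)
      show "(?r, (x, b x, c x)) \<in> ?D\<^sup>*"
        using step.IH step.prems by simp
    qed (use step.hyps step.prems mem in auto)
    moreover have "((x, b (x + 1), c (x + 1)), (x + 1, b (x + 1), c (x + 1))) \<in> ?D"
      using step mem b c by (auto simp: stack_def directed_step_def linked_def)
    ultimately show ?case by (rule rtrancl_into_rtrancl)
  qed
  show ?thesis
    unfolding directed_def
  proof (intro bexI ballI)
    show "?r \<in> ?P"
      using assms by (auto simp: stack_def linked_def)
    fix p assume "p \<in> ?P"
    then obtain x y z where "p = (x, y, z)" "x \<in> {m..M}" "y \<in> {b x..b' x}" "z \<in> {c x..c' x}"
      by (auto simp: stack_def)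
    then show "(?r, p) \<in> ?D\<^sup>*"
      using corner column by simp
  qed
qed

lemma fst_stack:
  assumes "linked m M b b'" and "linked m M c c'"
  shows "fst ` stack m M b b' c c' = {m..M}"
proof
  show "{m..M} \<subseteq> fst ` stack m M b b' c c'"
  proof
    fix x assume x: "x \<in> {m..M}"
    then have "(x, b x, c x) \<in> stack m M b b' c c'"
      using assms by (auto simp: stack_def linked_def)
    then show "x \<in> fst ` stack m M b b' c c'"
      by force
  qed
qed (auto simp: stack_def)

lemma width_stack:
  assumes "m \<le> M" "linked m M b b'" "linked m M c c'"
  shows "width (stack m M b b' c c') = M + 1 - m"
proof -
  have "Min {m..M} = m" "Max {m..M} = M"
    using assms(1) by (auto intro: Min_eqI Max_eqI)
  then show ?thesis
    using assms by (simp only: width_def fst_stack)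
qed

lemma directed_plateau_polycube_stack:
  assumes "m \<le> M" and b: "linked m M b b'" and c: "linked m M c c'"
  shows "directed_plateau_polycube (stack m M b b' c c')"
proof -
  let ?P = "stack m M b b' c c'"
  have "plateau (?P \<inter> layer x)" if x: "x \<in> {m..M}" for x
  proof -
    \<comment> \<open>A single layer is a stack of height one, hence directed and so connected.\<close>
    have eq: "?P \<inter> layer x = stack x x b b' c c'"
      using x by (auto simp: stack_def layer_def)
    have *: "linked x x b b'" "linked x x c c'"
      using b c x by (auto intro: linked_single)
    have "stratum (stack x x b b' c c')"
      using * by (simp add: stratum_def width_stack directed_imp_polycube finite_stack directed_stack)
    moreover have "stack x x b b' c c' = {x} \<times> {b x..b' x} \<times> {c x..c' x}"
      by (auto simp: stack_def)
    ultimately show ?thesis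
      unfolding eq plateau_def by blast
  qed
  moreover have "Min (fst ` ?P) = m" "Max (fst ` ?P) = M"
    unfolding fst_stack[OF b c] using assms(1) by (auto intro: Min_eqI Max_eqI)
  ultimately show ?thesis
    using assms
    by (simp add: directed_plateau_polycube_def plateau_polycube_def directed_stack
        directed_imp_polycube finite_stack)
qed

lemma directed_path_fst_mono:
  assumes "(u, v) \<in> {(u, v). u \<in> P \<and> v \<in> P \<and> directed_step u v}\<^sup>*"
  shows "fst u \<le> fst v"
  using assms
proof (induction rule: rtrancl_induct)
  case (step v w)
  then have "fst v \<le> fst w"
    by (auto simp: directed_step_def)
  with step.IH show ?case
    by (rule order_trans)
qed simp

text \<open>
  The root lies in the first layer because steps never decrease the first coordinate. So the least
  corner of a later layer is not the root and has a predecessor on some directed path; two of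
  the three candidates fall outside the rectangle, and the third is the cell before it in the
  previous layer.
\<close>

lemma directed_plateau_polycube_imp_stack:
  assumes "directed_plateau_polycube P"
  obtains m M b b' c c' where "m \<le> M" "linked m M b b'" "linked m M c c'"
    "P = stack m M b b' c c'"
proof -
  define m where "m = Min (fst ` P)"
  define M where "M = Max (fst ` P)"
  let ?D = "{(u, v). u \<in> P \<and> v \<in> P \<and> directed_step u v}"
  have fin: "finite (fst ` P)" and ne: "fst ` P \<noteq> {}"
    and plat: "\<And>x. x \<in> {m..M} \<Longrightarrow> plateau (P \<inter> layer x)"
    using assms
    by (auto simp: directed_plateau_polycube_def plateau_polycube_def polycube_def m_def M_def)
  have mM: "m \<le> M" and mP: "m \<in> fst ` P"
    using fin ne by (auto simp: m_def M_def)
  have fstP: "fst p \<in> {m..M}" if "p \<in> P" for p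
    using fin that by (auto simp: m_def M_def)
  have "\<exists>b b' c c'. P \<inter> layer x = {x} \<times> {b..b'} \<times> {c..c'} \<and> b \<le> b' \<and> c \<le> c'"
    if x: "x \<in> {m..M}" for x
  proof -
    obtain x' b b' c c' where eq: "P \<inter> layer x = {x'} \<times> {b..b'} \<times> {c..c'}"
      using plat[OF x] unfolding plateau_def by blast
    have "P \<inter> layer x \<noteq> {}"
      using plat[OF x] unfolding plateau_def stratum_def polycube_def by blast
    then have "b \<le> b'" "c \<le> c'"
      unfolding eq by auto
    moreover from this have "(x', b, c) \<in> P \<inter> layer x"
      unfolding eq by simp
    then have "x' = x"
      by (simp add: layer_def)
    ultimately show ?thesis
      using eq by blast
  qed
  then obtain b b' c c' where
    L: "\<And>x. x \<in> {m..M} \<Longrightarrow> P \<inter> layer x = {x} \<times> {b x..b' x} \<times> {c x..c' x}"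
    and le: "\<And>x. x \<in> {m..M} \<Longrightarrow> b x \<le> b' x \<and> c x \<le> c' x"
    by metis
  have mem: "(x, y, z) \<in> P \<longleftrightarrow> x \<in> {m..M} \<and> y \<in> {b x..b' x} \<and> z \<in> {c x..c' x}" for x y z
  proof (cases "x \<in> {m..M}")
    case True
    have "(x, y, z) \<in> P \<longleftrightarrow> (x, y, z) \<in> P \<inter> layer x"
      by (simp add: layer_def)
    also have "\<dots> \<longleftrightarrow> x \<in> {m..M} \<and> y \<in> {b x..b' x} \<and> z \<in> {c x..c' x}"
      unfolding L[OF True] using True by simp
    finally show ?thesis .
  next
    case False
    then show ?thesis
      using fstP[of "(x, y, z)"] by auto
  qed
  obtain r where r: "r \<in> P" and reach: "\<And>p. p \<in> P \<Longrightarrow> (r, p) \<in> ?D\<^sup>*"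
    using assms by (auto simp: directed_plateau_polycube_def directed_def)
  have fst_r: "fst r = m"
    using mP fstP[OF r] directed_path_fst_mono[OF reach] by force
  have link: "b (x + 1) \<in> {b x..b' x} \<and> c (x + 1) \<in> {c x..c' x}" if x: "x \<in> {m..<M}" for x
  proof -
    let ?p = "(x + 1, b (x + 1), c (x + 1))"
    have "?p \<in> P"
      using x le[of "x + 1"] by (simp add: mem)
    then have "(r, ?p) \<in> ?D\<^sup>*"
      by (rule reach)
    moreover have "r \<noteq> ?p"
      using fst_r x by auto
    ultimately obtain u where u: "u \<in> P" "directed_step u ?p"
      by (auto elim: rtranclE)
    obtain u1 u2 u3 where [simp]: "u = (u1, u2, u3)"
      by (cases u)
    show ?thesis
      using u mem[of u1 u2 u3] by (auto simp: directed_step_def)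
  qed
  show thesis
  proof (rule that[OF mM])
    show "linked m M b b'" "linked m M c c'"
      using le link by (auto simp: linked_def)
    show "P = stack m M b b' c c'"
      using mem by (auto simp: stack_def)
  qed
qed

lemma translate_stack:
  "(\<lambda>p. p + (t, s, w)) ` stack m M b b' c c' =
     stack (m + t) (M + t) (\<lambda>x. b (x - t) + s) (\<lambda>x. b' (x - t) + s)
       (\<lambda>x. c (x - t) + w) (\<lambda>x. c' (x - t) + w)" (is "?f ` ?S = ?T")
proof
  show "?f ` ?S \<subseteq> ?T"
    by (auto simp: stack_def)
  show "?T \<subseteq> ?f ` ?S"
  proof
    fix p assume "p \<in> ?T"
    then have "p - (t, s, w) \<in> ?S"
      by (auto simp: stack_def)
    then show "p \<in> ?f ` ?S"
      by (metis diff_add_cancel image_eqI)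
  qed
qed

lemma stack_cong:
  assumes "\<And>x. x \<in> {m..M} \<Longrightarrow> b x = d x \<and> b' x = d' x \<and> c x = e x \<and> c' x = e' x"
  shows "stack m M b b' c c' = stack m M d d' e e'"
  using assms by (auto simp: stack_def)

text \<open>
  Nonempty rectangles determine their sides; linking ensures that the layers are nonempty.
\<close>

lemma stack_eq_imp:
  assumes eq: "stack m M b b' c c' = stack m M d d' e e'"
    and b: "linked m M b b'" and c: "linked m M c c'" and x: "x \<in> {m..M}"
  shows "b x = d x \<and> b' x = d' x \<and> c x = e x \<and> c' x = e' x"
proof -
  have "{b x..b' x} \<times> {c x..c' x} = snd ` (stack m M b b' c c' \<inter> layer x)"
    using x by (force simp: stack_def layer_def)
  also have "\<dots> = {d x..d' x} \<times> {e x..e' x}"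
    using x unfolding eq by (force simp: stack_def layer_def)
  finally have "{b x..b' x} = {d x..d' x}" "{c x..c' x} = {e x..e' x}"
    using b c x by (auto simp: times_eq_iff linked_def)
  then show ?thesis
    using b c x by (auto simp: Icc_eq_Icc linked_def)
qed

lemma lateral_area_stack:
  assumes b: "linked m M b b'" and c: "linked m M c c'"
  shows "lateral_area (stack m M b b' c c') =
    (\<Sum>x\<in>{m..M}. nat (b' x - b x + 1) + nat (c' x - c x + 1))"
proof -
  let ?P = "stack m M b b' c c'"
  have "(\<lambda>(x, y, z). (x, y)) ` ?P = (SIGMA x:{m..M}. {b x..b' x})"
  proof (intro equalityI subsetI)
    fix q assume "q \<in> (SIGMA x:{m..M}. {b x..b' x})"
    then obtain x y where q: "q = (x, y)" "x \<in> {m..M}" "y \<in> {b x..b' x}" by auto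
    then have "(x, y, c x) \<in> ?P"
      using c by (auto simp: stack_def linked_def)
    then show "q \<in> (\<lambda>(x, y, z). (x, y)) ` ?P"
      using q by force
  qed (auto simp: stack_def)
  moreover have "(\<lambda>(x, y, z). (x, z)) ` ?P = (SIGMA x:{m..M}. {c x..c' x})"
  proof (intro equalityI subsetI)
    fix q assume "q \<in> (SIGMA x:{m..M}. {c x..c' x})"
    then obtain x z where q: "q = (x, z)" "x \<in> {m..M}" "z \<in> {c x..c' x}" by auto
    then have "(x, b x, z) \<in> ?P"
      using b by (auto simp: stack_def linked_def)
    then show "q \<in> (\<lambda>(x, y, z). (x, z)) ` ?P"
      using q by force
  qed (auto simp: stack_def)
  ultimately show ?thesis
    by (simp add: lateral_area_def card_SigmaI sum.distrib algebra_simps)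
qed

section \<open>Linked intervals as sequences of increments\<close>

text \<open>
  For a stack starting at first coordinate \<open>0\<close>, \<open>u\<close> lists the offsets between the left ends of
  successive intervals, and \<open>v\<close> the distances from the left end of the next interval to the right
  end of the present one. The last interval has no successor; fixing \<open>v\<close> to be \<open>0\<close> there lets its
  length be recorded by \<open>u\<close> alone, as if a further interval started at its right end.
\<close>

definition low :: "(nat \<Rightarrow> nat) \<Rightarrow> int \<Rightarrow> int" where
  "low u x = (\<Sum>j<nat x. int (u j))"

definition high :: "(nat \<Rightarrow> nat) \<Rightarrow> (nat \<Rightarrow> nat) \<Rightarrow> int \<Rightarrow> int" where
  "high u v x = low u (x + 1) + int (v (nat x))"

lemma low_0 [simp]: "low u 0 = 0"
  by (simp add: low_def)

lemma low_step: "x \<ge> 0 \<Longrightarrow> low u (x + 1) = low u x + int (u (nat x))"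
  by (simp add: low_def nat_add_distrib)

lemma linked_low_high: "linked 0 M (low u) (high u v)"
  by (auto simp: linked_def high_def low_step)

text \<open>
  Extending the left ends by the right end of the last interval gives a sequence \<open>B\<close> that is
  nondecreasing and satisfies \<open>B (x + 1) \<le> b' (m + x)\<close> also for the last layer, where equality holds.
  The increments of \<open>B\<close> are \<open>u\<close>, and the slack in the inequality is \<open>v\<close>.
\<close>

lemma linked_increments:
  assumes "linked m (m + int k - 1) b b'" and "k \<ge> 1"
  obtains u v where "v (k - 1) = 0"
    and "\<And>x. x \<in> {0..int k - 1} \<Longrightarrow> b (m + x) = b m + low u x \<and> b' (m + x) = b m + high u v x"
proof -
  define B where "B x = (if x < int k then b (m + x) else b' (m + int k - 1))" for x
  define u where "u j = nat (B (int j + 1) - B (int j))" for j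
  define v where "v j = nat (b' (m + int j) - B (int j + 1))" for j
  have B: "B x \<le> B (x + 1)" "B (x + 1) \<le> b' (m + x)" if "x \<in> {0..int k - 1}" for x
  proof -
    have *: "b (m + x) \<le> b' (m + x)"
      using assms that by (simp add: linked_def)
    have "b (m + x + 1) \<in> {b (m + x)..b' (m + x)}" if "x + 1 < int k"
      using assms that \<open>x \<in> {0..int k - 1}\<close> by (simp add: linked_def)
    moreover have "b' (m + int k - 1) = b' (m + x)" if "\<not> x + 1 < int k"
      using that \<open>x \<in> {0..int k - 1}\<close> by (intro arg_cong[where f = b']) simp
    ultimately show "B x \<le> B (x + 1)" "B (x + 1) \<le> b' (m + x)"
      using * that by (auto simp: B_def add.assoc[symmetric])
  qed
  have low: "low u x = B x - b m" if "0 \<le> x" "x \<le> int k" for x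
    using that
  proof (induction x rule: int_ge_induct)
    case base
    then show ?case using assms(2) by (simp add: B_def)
  next
    case (step x)
    then show ?case using B[of x] by (simp add: low_step u_def)
  qed
  show thesis
  proof (rule that)
    show "v (k - 1) = 0"
      using assms(2) by (simp add: v_def B_def of_nat_diff algebra_simps)
    show "b (m + x) = b m + low u x \<and> b' (m + x) = b m + high u v x"
      if "x \<in> {0..int k - 1}" for x
      using that low[of x] low[of "x + 1"] B[OF that] by (simp add: high_def v_def B_def)
  qed
qed

text \<open>
  The common translation \<open>t\<close> vanishes because \<open>low\<close> is normalised to \<open>0\<close> at \<open>0\<close>. Differences of
  left ends then recover \<open>u\<close> below the last layer, and the length of the last interval recovers
  its last value, because \<open>v\<close> is \<open>0\<close> there.
\<close>

lemma increments_unique: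
  assumes low: "\<And>x. x \<in> {0..int k - 1} \<Longrightarrow> low u x + t = low u' x"
    and high: "\<And>x. x \<in> {0..int k - 1} \<Longrightarrow> high u v x + t = high u' v' x"
    and last: "v (k - 1) = 0" "v' (k - 1) = 0" and j: "j < k"
  shows "u j = u' j \<and> v j = v' j"
proof -
  have t: "t = 0"
    using low[of 0] j by simp
  have eqh: "low u (int j + 1) + int (v j) = low u' (int j + 1) + int (v' j)"
    using high[of "int j"] j t by (simp add: high_def)
  have eql: "low u (int j) = low u' (int j)"
    using low[of "int j"] j t by simp
  have "low u (int j + 1) = low u' (int j + 1)"
  proof (cases "Suc j < k")
    case True
    then show ?thesis using low[of "int j + 1"] t by simp
  next
    case False
    then have "j = k - 1" using j by simp
    then show ?thesis using eqh last by simp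
  qed
  then show ?thesis
    using eqh eql by (simp add: low_step)
qed

section \<open>Coding by lists of natural numbers\<close>

text \<open>
  The four sequences of increments of a stack, two for each lateral direction, are interleaved in
  one list. The sequences \<open>v\<close> of the two directions take the residues \<open>2\<close> and \<open>3\<close> modulo \<open>4\<close>, so
  that their two values in the last layer, which must be \<open>0\<close>, are the last two entries of a list
  of length \<open>4 * k\<close>. Cutting these off leaves \<open>4 * k - 2\<close> unconstrained entries, and the default
  value \<open>0\<close> restores them.
\<close>

definition strand :: "nat \<Rightarrow> nat list \<Rightarrow> nat \<Rightarrow> nat" where
  "strand r l j = nth_default 0 l (4 * j + r)"

definition decode :: "nat \<Rightarrow> nat list \<Rightarrow> cell set" where
  "decode k l = stack 0 (int k - 1)
     (low (strand 0 l)) (high (strand 0 l) (strand 2 l))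
     (low (strand 1 l)) (high (strand 1 l) (strand 3 l))"

lemma strand_last:
  assumes "length l = 4 * k - 2" "k \<ge> 1"
  shows "strand 2 l (k - 1) = 0" "strand 3 l (k - 1) = 0"
proof -
  have "length l \<le> 4 * (k - 1) + 2" "length l \<le> 4 * (k - 1) + 3"
    using assms by auto
  then show "strand 2 l (k - 1) = 0" "strand 3 l (k - 1) = 0"
    by (simp_all only: strand_def nth_default_beyond)
qed

lemma sum_strands:
  assumes "length l \<le> 4 * k"
  shows "(\<Sum>j<k. strand 0 l j + strand 1 l j + strand 2 l j + strand 3 l j) = sum_list l"
proof -
  have "(\<Sum>j<k. strand 0 l j + strand 1 l j + strand 2 l j + strand 3 l j) =
      (\<Sum>i<4 * k. nth_default 0 l i)"
    by (induction k) (simp_all add: strand_def eval_nat_numeral)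
  also have "\<dots> = (\<Sum>i<length l. nth_default 0 l i)"
    using assms by (intro sum.mono_neutral_right) (auto simp: nth_default_def)
  also have "\<dots> = sum_list l"
    by (simp add: nth_default_def sum_list_sum_nth atLeast0LessThan)
  finally show ?thesis .
qed

text \<open>
  The interval in one direction at layer \<open>j\<close> has \<open>u j + v j + 1\<close> elements; the two directions and
  the \<open>k\<close> layers account for the summand \<open>2 * k\<close>.
\<close>

lemma lateral_area_decode:
  assumes "length l = 4 * k - 2"
  shows "lateral_area (decode k l) = 2 * k + sum_list l"
proof -
  let ?g = "\<lambda>x. nat (high (strand 0 l) (strand 2 l) x - low (strand 0 l) x + 1) +
              nat (high (strand 1 l) (strand 3 l) x - low (strand 1 l) x + 1)"
  have "lateral_area (decode k l) = sum ?g {0..int k - 1}"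
    unfolding decode_def by (intro lateral_area_stack linked_low_high)
  also have "{0..int k - 1} = int ` {..<k}"
    by (auto simp: lessThan_atLeast0 image_int_atLeastLessThan)
  also have "sum ?g (int ` {..<k}) = (\<Sum>j<k. ?g (int j))"
    by (simp add: sum.reindex)
  also have "\<dots> = (\<Sum>j<k. 2 + (strand 0 l j + strand 1 l j + strand 2 l j + strand 3 l j))"
    by (intro sum.cong refl) (simp add: high_def low_step nat_add_distrib)
  also have "\<dots> = 2 * k + sum_list l"
    using assms by (subst sum.distrib, subst sum_strands) auto
  finally show ?thesis .
qed

lemma directed_plateau_polycube_decode:
  "k \<ge> 1 \<Longrightarrow> directed_plateau_polycube (decode k l)"
  by (simp add: decode_def directed_plateau_polycube_stack linked_low_high)

lemma width_decode: "k \<ge> 1 \<Longrightarrow> width (decode k l) = int k"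
  by (simp add: decode_def width_stack linked_low_high)

lemma decode_surj:
  assumes "directed_plateau_polycube P" and "width P = int k" and "k \<ge> 1"
  obtains l t where "length l = 4 * k - 2" "P = (\<lambda>p. p + t) ` decode k l"
proof -
  obtain m M b b' c c' where mM: "m \<le> M" and b: "linked m M b b'" and c: "linked m M c c'"
    and P: "P = stack m M b b' c c'"
    using assms(1) by (rule directed_plateau_polycube_imp_stack)
  have M: "M = m + int k - 1"
    using assms(2) mM b c by (simp add: P width_stack)
  obtain u v where v: "v (k - 1) = 0" and uv: "\<And>x. x \<in> {0..int k - 1} \<Longrightarrow>
      b (m + x) = b m + low u x \<and> b' (m + x) = b m + high u v x"
    using linked_increments[OF b[unfolded M] assms(3)] by blast
  obtain u' v' where v': "v' (k - 1) = 0" and uv': "\<And>x. x \<in> {0..int k - 1} \<Longrightarrow>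
      c (m + x) = c m + low u' x \<and> c' (m + x) = c m + high u' v' x"
    using linked_increments[OF c[unfolded M] assms(3)] by blast
  define l where "l = map (\<lambda>i. ([u, u', v, v'] ! (i mod 4)) (i div 4)) [0..<4 * k - 2]"
  have entry: "strand i l j = ([u, u', v, v'] ! i) j" if "j < k" "i < 4" for i j
  proof (cases "4 * j + i < 4 * k - 2")
    case True
    have "(4 * j + i) mod 4 = i" "(4 * j + i) div 4 = j"
      using that(2) by simp_all
    then show ?thesis
      using True by (simp add: strand_def l_def nth_default_def)
  next
    case False
    \<comment> \<open>Beyond the end of the list: both sides are \<open>0\<close>.\<close>
    then have "j = k - 1" and "i = 2 \<or> i = 3"
      using that by presburger+
    moreover have "strand i l j = 0"
      using False by (simp add: strand_def l_def nth_default_def)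
    ultimately show ?thesis
      using v v' by (auto simp: numeral_3_eq_3)
  qed
  have strand: "strand 0 l j = u j \<and> strand 1 l j = u' j \<and> strand 2 l j = v j \<and> strand 3 l j = v' j"
    if "j < k" for j
    using entry[OF that, of 0] entry[OF that, of 1] entry[OF that, of 2] entry[OF that, of 3]
    by (simp add: numeral_3_eq_3)
  have low: "low (strand 0 l) x = low u x" "low (strand 1 l) x = low u' x" if "x \<le> int k" for x
    using that strand by (auto simp: low_def intro!: sum.cong)
  have top: "int k - 1 + m = m + int k - 1"
    by simp
  have "P = (\<lambda>p. p + (m, b m, c m)) ` decode k l"
    unfolding decode_def translate_stack P M top add_0
  proof (rule stack_cong)
    fix x assume x: "x \<in> {m..m + int k - 1}"
    then show "b x = low (strand 0 l) (x - m) + b m \<and>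
          b' x = high (strand 0 l) (strand 2 l) (x - m) + b m \<and>
          c x = low (strand 1 l) (x - m) + c m \<and>
          c' x = high (strand 1 l) (strand 3 l) (x - m) + c m"
      using uv[of "x - m"] uv'[of "x - m"] low[of "x - m"] low[of "x - m + 1"]
        strand[of "nat (x - m)"] nat_less_iff[of "x - m" k]
      by (simp add: high_def)
  qed
  moreover have "length l = 4 * k - 2"
    by (simp add: l_def)
  ultimately show thesis
    using that by blast
qed

lemma decode_inj:
  assumes l: "length l = 4 * k - 2" and l': "length l' = 4 * k - 2" and k: "k \<ge> 1"
    and eq: "decode k l' = (\<lambda>p. p + t) ` decode k l"
  shows "l = l'"
proof -
  obtain t0 s w where t: "t = (t0, s, w)"
    by (cases t)
  let ?b = "\<lambda>x. low (strand 0 l) (x - t0) + s" and ?b' = "\<lambda>x. high (strand 0 l) (strand 2 l) (x - t0) + s"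
  let ?c = "\<lambda>x. low (strand 1 l) (x - t0) + w" and ?c' = "\<lambda>x. high (strand 1 l) (strand 3 l) (x - t0) + w"
  have *: "decode k l' = stack t0 (int k - 1 + t0) ?b ?b' ?c ?c'"
    unfolding eq t unfolding decode_def translate_stack by simp
  have lk: "linked t0 (int k - 1 + t0) ?b ?b'" "linked t0 (int k - 1 + t0) ?c ?c'"
    using linked_low_high[of "int k - 1" "strand 0 l" "strand 2 l"]
      linked_low_high[of "int k - 1" "strand 1 l" "strand 3 l"]
    by (auto dest: linked_translate[where t = t0 and s = s] linked_translate[where t = t0 and s = w])
  have "{0..int k - 1} = fst ` decode k l'"
    unfolding decode_def by (simp add: fst_stack linked_low_high)
  also have "\<dots> = {t0..int k - 1 + t0}"
    unfolding * by (rule fst_stack[OF lk])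
  finally have t0: "t0 = 0"
    using k by (simp add: Icc_eq_Icc)
  have E: "?b x = low (strand 0 l') x \<and> ?b' x = high (strand 0 l') (strand 2 l') x \<and>
      ?c x = low (strand 1 l') x \<and> ?c' x = high (strand 1 l') (strand 3 l') x"
    if "x \<in> {0..int k - 1}" for x
    using stack_eq_imp[OF *[symmetric, unfolded decode_def t0 add_0_right] _ _ that] lk
    unfolding t0 by simp
  have 1: "strand 0 l j = strand 0 l' j \<and> strand 2 l j = strand 2 l' j" if "j < k" for j
    by (rule increments_unique[where t = s and k = k])
      (use E t0 strand_last[OF l k] strand_last[OF l' k] that in auto)
  have 2: "strand 1 l j = strand 1 l' j \<and> strand 3 l j = strand 3 l' j" if "j < k" for j
    by (rule increments_unique[where t = w and k = k])
      (use E t0 strand_last[OF l k] strand_last[OF l' k] that in auto)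
  show ?thesis
  proof (rule nth_equalityI)
    fix i assume i: "i < length l"
    have "strand (i mod 4) l (i div 4) = strand (i mod 4) l' (i div 4)"
    proof -
      have "i div 4 < k"
        using i l by simp
      moreover have "i mod 4 \<in> {0, 1, 2, 3}"
        by auto
      ultimately show ?thesis
        using 1 2 by auto
    qed
    then show "l ! i = l' ! i"
      using i l l' by (simp add: strand_def nth_default_def)
  qed (simp add: l l')
qed

section \<open>Counting up to translation\<close>

lemma translation_relI: "Q = (\<lambda>x. x + t) ` P \<Longrightarrow> (P, Q) \<in> translation_rel"
  unfolding translation_rel_def by blast

lemma equiv_translation_rel: "equiv UNIV translation_rel"
proof (rule equivI)
  show "refl translation_rel"
    by (auto intro!: refl_onI translation_relI[where t = 0])
  show "sym translation_rel"
  proof (rule symI)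
    fix P Q assume "(P, Q) \<in> translation_rel"
    then obtain t where "Q = (\<lambda>x. x + t) ` P"
      by (auto simp: translation_rel_def)
    then have "P = (\<lambda>x. x + - t) ` Q"
      by (simp add: image_image)
    then show "(Q, P) \<in> translation_rel"
      by (rule translation_relI)
  qed
  show "trans translation_rel"
  proof (rule transI)
    fix P Q R assume "(P, Q) \<in> translation_rel" "(Q, R) \<in> translation_rel"
    then obtain s t where "R = (\<lambda>x. x + t) ` (\<lambda>x. x + s) ` P"
      by (auto simp: translation_rel_def)
    then have "R = (\<lambda>x. x + (s + t)) ` P"
      by (simp add: image_image add.assoc)
    then show "(P, R) \<in> translation_rel"
      by (rule translation_relI)
  qed
qed auto

lemma lateral_area_translate: "lateral_area ((\<lambda>p. p + t) ` P) = lateral_area P"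
proof -
  obtain t0 s w where t: "t = (t0, s, w)"
    by (cases t)
  have "(\<lambda>(x, y, z). (x, y)) ` (\<lambda>p. p + t) ` P = (\<lambda>q. q + (t0, s)) ` (\<lambda>(x, y, z). (x, y)) ` P"
    and "(\<lambda>(x, y, z). (x, z)) ` (\<lambda>p. p + t) ` P = (\<lambda>q. q + (t0, w)) ` (\<lambda>(x, y, z). (x, z)) ` P"
    by (auto simp: t image_image split_def intro!: image_cong)
  then show ?thesis
    by (simp add: lateral_area_def card_image)
qed

lemma card_quotient_representatives:
  assumes R: "equiv UNIV R"
    and mem: "\<And>i. i \<in> I \<Longrightarrow> f i \<in> A"
    and inj: "\<And>i j. i \<in> I \<Longrightarrow> j \<in> I \<Longrightarrow> (f i, f j) \<in> R \<Longrightarrow> i = j"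
    and surj: "\<And>a. a \<in> A \<Longrightarrow> \<exists>i\<in>I. (f i, a) \<in> R"
  shows "card (A // R) = card I"
proof -
  have "bij_betw (\<lambda>i. R `` {f i}) I (A // R)"
    unfolding bij_betw_def
  proof
    show "inj_on (\<lambda>i. R `` {f i}) I"
      using inj eq_equiv_class[OF _ R] by (intro inj_onI) blast
    show "(\<lambda>i. R `` {f i}) ` I = A // R"
    proof
      show "(\<lambda>i. R `` {f i}) ` I \<subseteq> A // R"
        using mem by (auto intro: quotientI)
      show "A // R \<subseteq> (\<lambda>i. R `` {f i}) ` I"
      proof
        fix X assume "X \<in> A // R"
        then obtain a where "a \<in> A" and X: "X = R `` {a}"
          by (auto elim: quotientE)
        with surj obtain i where "i \<in> I" "(f i, a) \<in> R"
          by blast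
        then show "X \<in> (\<lambda>i. R `` {f i}) ` I"
          using equiv_class_eq[OF R] X by blast
      qed
    qed
  qed
  then show ?thesis
    by (simp add: bij_betw_same_card)
qed

theorem theorem3p2:
  fixes k n :: nat
  assumes "k \<ge> 1" and "n \<ge> 2 * k"
  shows "num_directed_plateau k n = (n + 2 * k - 3) choose (n - 2 * k)"
proof -
  let ?I = "{l :: nat list. length l = 4 * k - 2 \<and> sum_list l = n - 2 * k}"
  have "num_directed_plateau k n = card ?I"
    unfolding num_directed_plateau_def
  proof (rule card_quotient_representatives[OF equiv_translation_rel, where f = "decode k"])
    fix l assume "l \<in> ?I"
    then show "decode k l \<in>
        {P. directed_plateau_polycube P \<and> width P = int k \<and> lateral_area P = n}"
      using assms by (simp add: directed_plateau_polycube_decode width_decode lateral_area_decode)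
  next
    fix l l' assume "l \<in> ?I" "l' \<in> ?I" "(decode k l, decode k l') \<in> translation_rel"
    then show "l = l'"
      using assms(1) decode_inj[of l k l'] by (auto simp: translation_rel_def)
  next
    fix P assume "P \<in> {P. directed_plateau_polycube P \<and> width P = int k \<and> lateral_area P = n}"
    then have P: "directed_plateau_polycube P" "width P = int k" "lateral_area P = n"
      by auto
    obtain l t where l: "length l = 4 * k - 2" and Pl: "P = (\<lambda>p. p + t) ` decode k l"
      using decode_surj[OF P(1,2) assms(1)] .
    have "n = 2 * k + sum_list l"
      using P(3) by (simp add: Pl lateral_area_translate lateral_area_decode[OF l])
    then show "\<exists>l\<in>?I. (decode k l, P) \<in> translation_rel"
      using l translation_relI[OF Pl] by auto
  qed
  also have "card ?I = ((n - 2 * k) + (4 * k - 2) - 1) choose (n - 2 * k)"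
    by (rule card_length_sum_list)
  also have "(n - 2 * k) + (4 * k - 2) - 1 = n + 2 * k - 3"
    using assms by simp
  finally show ?thesis .
qed

end
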